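(* Let $w$ be a positive integer and let $m_0,m_1,\dots,m_{w-1}$ be positive integers. Then (1) the sequence $\left\{\prod_{k=0}^{w-1}(n^2-k^2)^{m_k}\right\}_{n=0}^{\infty}$ is a $\mathcal{T}$-CZDS, and (2) the sequence $\left\{\prod_{k=0}^{w-1}\big(n(n+2)-k(k+2)\big)^{m_k}\right\}_{n=0}^{\infty}$ is a $\mathcal{U}$-CZDS, where $\mathcal{T}=\{T_n(x)\}_{n=0}^\infty$ and $\mathcal{U}=\{U_n(x)\}_{n=0}^\infty$ are the Chebyshev polynomials of the first and second kind, respectively.
   Context: For a non-zero function $f$, $Z_C(f)$ denotes the number of non-real zeros of $f$ in $\mathbb{C}$, counted according to multiplicity; for the identically zero function, $Z_C(0)=0$. Let $B=\{b_k\}_{k=0}^\infty$ be a basis of $\mathbb{R}[x]$. A sequence of real numbers $\{\gamma_k\}_{k=0}^\infty$ is a complex zero decreasing sequence for the basis $B$ (a $B$-CZDS) if the linear operator $L:\mathbb{R}[x]\to\mathbb{R}[x]$ determined by $L(b_k)=\gamma_k b_k$ ($k=0,1,2,\dots$) satisfies $Z_C(L(p))\le Z_C(p)$ for every real polynomial $p$. For real $\lambda>-1$, put $$P_n^{(\lambda)}(x)=\frac{(-1)^n(1-x)^{-\lambda}(1+x)^{-\lambda}}{2^n n!}\frac{d^n}{dx^n}\left[(1-x)^{n+\lambda}(1+x)^{n+\lambda}\right]\qquad(n=0,1,2,\dots),$$ computed on $(-1,1)$, which is a polynomial of degree $n$ (ultraspherical polynomial). With the rising factorial $(a)_n:=a(a+1)\cdots(a+n-1)$,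 $(a)_0=1$, the Chebyshev polynomials are defined by $$T_n(x):=\frac{n!}{(\frac12)_n}P_n^{(-1/2)}(x),\qquad U_n(x):=\frac{(n+1)!}{(\frac32)_n}P_n^{(1/2)}(x)\qquad(n=0,1,2,\dots).$$ *)

theory Defs
  imports
    "HOL-Analysis.Analysis"
    "HOL-Computational_Algebra.Computational_Algebra"
begin

text \<open>
  \<^term>\<open>order z q\<close> is the multiplicity of \<^term>\<open>z\<close> as a root of \<^term>\<open>q\<close>; for a
  non-zero polynomial the index set of the sum is finite.
\<close>

definition nonreal_zeros :: "real poly \<Rightarrow> nat" ("Z\<^sub>C") where
  "Z\<^sub>C p =
     (if p = 0 then 0
      else \<Sum>z\<in>{z. poly (map_poly complex_of_real p) z = 0 \<and> Im z \<noteq> 0}.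
             order z (map_poly complex_of_real p))"

text \<open>
  The library has no \<^class>\<open>real_vector\<close> instance for polynomials, so linear algebra over
  the reals is taken from the \<^locale>\<open>vector_space\<close> locale with scaling \<^const>\<open>smult\<close>.
\<close>

global_interpretation real_poly: vector_space "smult :: real \<Rightarrow> real poly \<Rightarrow> real poly"
  by unfold_locales (simp_all add: smult_add_right smult_add_left)

definition real_poly_basis :: "(nat \<Rightarrow> real poly) \<Rightarrow> bool" where
  "real_poly_basis b \<longleftrightarrow>
     inj b \<and> real_poly.independent (range b) \<and> real_poly.span (range b) = UNIV"

text \<open>
  Since \<^term>\<open>b\<close> is required to be a basis, there is exactly one linear operator with
  the prescribed values, so the existential quantifier merely names it.
\<close>

definition CZDS :: "(nat \<Rightarrow> real poly) \<Rightarrow> (nat \<Rightarrow> real) \<Rightarrow> bool" where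
  "CZDS b \<gamma> \<longleftrightarrow>
     real_poly_basis b \<and>
     (\<exists>L. Vector_Spaces.linear smult smult L \<and>
          (\<forall>k. L (b k) = smult (\<gamma> k) (b k)) \<and>
          (\<forall>p. Z\<^sub>C (L p) \<le> Z\<^sub>C p))"

text \<open>
  The polynomial is only meaningful for \<open>\<alpha> > -1\<close>. Real powers are
  \<^const>\<open>powr\<close>, which is the usual power here because both bases are positive on the
  interval. Existence and uniqueness are shown below.
\<close>

definition ultraspherical :: "real \<Rightarrow> nat \<Rightarrow> real poly" where
  "ultraspherical \<alpha> n =
     (THE p. \<forall>x\<in>{-1<..<1}. poly p x =
        (-1) ^ n * (1 - x) powr (- \<alpha>) * (1 + x) powr (- \<alpha>) / (2 ^ n * fact n) *
        (deriv ^^ n) (\<lambda>t. (1 - t) powr (real n + \<alpha>) * (1 + t) powr (real n + \<alpha>)) x)"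

definition chebyshev_T :: "nat \<Rightarrow> real poly" where
  "chebyshev_T n = smult (fact n / pochhammer (1/2) n) (ultraspherical (-1/2) n)"

definition chebyshev_U :: "nat \<Rightarrow> real poly" where
  "chebyshev_U n = smult (fact (n + 1) / pochhammer (3/2) n) (ultraspherical (1/2) n)"

fun rodrigues_factor :: "real \<Rightarrow> nat \<Rightarrow> real poly" where
  "rodrigues_factor a 0 = 1"
| "rodrigues_factor a (Suc k) =
     pderiv (rodrigues_factor a k) * [:1, 0, -1:]
     - smult (2 * (a - real k)) (rodrigues_factor a k * [:0, 1:])"

lemma higher_deriv_rodrigues:
  assumes "x \<in> {-1<..<1}"
  shows "(deriv ^^ k) (\<lambda>t. (1 - t) powr a * (1 + t) powr a) x =
           poly (rodrigues_factor a k) x * (1 - x\<^sup>2) powr (a - real k)"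
  using assms
proof (induction k arbitrary: x)
  case 0
  have "1 - x\<^sup>2 = (1 - x) * (1 + x)" by (simp add: power2_eq_square algebra_simps)
  then show ?case using 0 by (simp add: powr_mult)
next
  case (Suc k)
  let ?q = "rodrigues_factor a k"
  have pos: "1 - x\<^sup>2 > 0" using Suc.prems by (auto simp: abs_square_less_1 abs_less_iff)
  have ev: "\<forall>\<^sub>F y in nhds x. y \<in> {-1<..<1}"
    using Suc.prems by (intro eventually_nhds_in_open) auto
  have "((\<lambda>x. 1 - x\<^sup>2) has_real_derivative - (2 * x)) (at x)"
    by (auto intro!: derivative_eq_intros)
  from DERIV_fun_powr[OF this pos, of "a - real k"]
  have pw: "((\<lambda>x. (1 - x\<^sup>2) powr (a - real k)) has_real_derivative
      (a - real k) * (1 - x\<^sup>2) powr (a - real k - 1) * - (2 * x)) (at x)"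
    by simp
  have "deriv ((deriv ^^ k) (\<lambda>t. (1 - t) powr a * (1 + t) powr a)) x =
        deriv (\<lambda>x. poly ?q x * (1 - x\<^sup>2) powr (a - real k)) x"
    by (intro deriv_cong_ev eventually_mono[OF ev] Suc.IH) auto
  also have "\<dots> = poly (pderiv ?q) x * (1 - x\<^sup>2) powr (a - real k)
      - poly ?q x * ((a - real k) * (1 - x\<^sup>2) powr (a - real k - 1) * (2 * x))"
    using DERIV_imp_deriv[OF DERIV_mult[OF poly_DERIV[of ?q x] pw]] by (simp add: algebra_simps)
  also have "(1 - x\<^sup>2) powr (a - real k) = (1 - x\<^sup>2) powr (a - real k - 1) * (1 - x\<^sup>2)"
    using pos by (simp add: powr_diff)
  also have "a - real k - 1 = a - real (Suc k)" by simp
  finally show ?case by (simp add: algebra_simps power2_eq_square)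
qed

lemma rodrigues_factor_degree:
  assumes "a > real n - 1" "k \<le> n"
  shows "degree (rodrigues_factor a k) = k \<and> coeff (rodrigues_factor a k) k \<noteq> 0"
  using assms(2)
proof (induction k)
  case (Suc k)
  let ?q = "rodrigues_factor a k"
  have deg: "degree ?q = k" and lc: "coeff ?q k \<noteq> 0" using Suc by auto
  have hi: "coeff ?q j = 0" if "j > k" for j using that deg by (simp add: coeff_eq_0)
  have eq: "rodrigues_factor a (Suc k) =
      pderiv ?q - pCons 0 (pCons 0 (pderiv ?q)) - smult (2 * (a - real k)) (pCons 0 ?q)"
    by (simp add: algebra_simps)
  have "coeff (rodrigues_factor a (Suc k)) j = 0" if "j > Suc k" for j
    using that by (auto simp: eq coeff_pderiv coeff_pCons hi split: nat.splits)
  then have le: "degree (rodrigues_factor a (Suc k)) \<le> Suc k" by (simp add: degree_le)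
  have "coeff (rodrigues_factor a (Suc k)) (Suc k) = (real k - 2 * a) * coeff ?q k"
    by (auto simp: eq coeff_pderiv coeff_pCons hi algebra_simps split: nat.splits)
  moreover have "real k - 2 * a \<noteq> 0" using Suc.prems assms(1) by auto
  ultimately have "coeff (rodrigues_factor a (Suc k)) (Suc k) \<noteq> 0" using lc by simp
  with le show ?case by (simp add: le_antisym le_degree)
qed simp

lemma ultraspherical_eq_rodrigues_factor:
  "ultraspherical \<alpha> n =
     smult ((-1) ^ n / (2 ^ n * fact n)) (rodrigues_factor (real n + \<alpha>) n)" (is "_ = ?p")
  and poly_ultraspherical:
  "x \<in> {-1<..<1} \<Longrightarrow> poly (ultraspherical \<alpha> n) x =
     (-1) ^ n * (1 - x) powr (- \<alpha>) * (1 + x) powr (- \<alpha>) / (2 ^ n * fact n) *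
     (deriv ^^ n) (\<lambda>t. (1 - t) powr (real n + \<alpha>) * (1 + t) powr (real n + \<alpha>)) x"
proof -
  let ?r = "\<lambda>x. (-1) ^ n * (1 - x) powr (- \<alpha>) * (1 + x) powr (- \<alpha>) / (2 ^ n * fact n) *
     (deriv ^^ n) (\<lambda>t. (1 - t) powr (real n + \<alpha>) * (1 + t) powr (real n + \<alpha>)) x"
  have ex: "poly ?p x = ?r x" if x: "x \<in> {-1<..<1}" for x
  proof -
    have "1 - x\<^sup>2 = (1 - x) * (1 + x)" by (simp add: power2_eq_square algebra_simps)
    then have "(1 - x\<^sup>2) powr \<alpha> = (1 - x) powr \<alpha> * (1 + x) powr \<alpha>"
      using x by (simp add: powr_mult)
    then have "(1 - x) powr (- \<alpha>) * (1 + x) powr (- \<alpha>) * (1 - x\<^sup>2) powr \<alpha> = 1"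
      using x by (auto simp: powr_minus field_simps)
    moreover have "?r x = (-1) ^ n / (2 ^ n * fact n) * poly (rodrigues_factor (real n + \<alpha>) n) x *
        ((1 - x) powr (- \<alpha>) * (1 + x) powr (- \<alpha>) * (1 - x\<^sup>2) powr \<alpha>)"
      by (simp add: higher_deriv_rodrigues[OF x])
    ultimately show ?thesis by simp
  qed
  have uniq: "p = ?p" if "\<forall>x\<in>{-1<..<1}. poly p x = ?r x" for p
  proof (rule ccontr)
    assume "p \<noteq> ?p"
    then have "finite {x. poly (p - ?p) x = 0}" by (intro poly_roots_finite) simp
    moreover have "{-1<..<1} \<subseteq> {x. poly (p - ?p) x = 0}" using that ex by auto
    ultimately have "finite {-1<..<1::real}" by (rule rev_finite_subset)
    then show False using infinite_Ioo[of "-1::real" 1] by simp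
  qed
  show eq: "ultraspherical \<alpha> n = ?p"
    unfolding ultraspherical_def by (rule the_equality) (use ex uniq in blast)+
  show "poly (ultraspherical \<alpha> n) x = ?r x" if "x \<in> {-1<..<1}"
    unfolding eq using ex that by blast
qed

lemma degree_ultraspherical:
  assumes "\<alpha> > -1"
  shows "degree (ultraspherical \<alpha> n) = n"
  using rodrigues_factor_degree[of n "real n + \<alpha>" n] assms
  by (simp add: ultraspherical_eq_rodrigues_factor)

end

theory Submission
  imports Defs
begin

text \<open>
  For \<open>\<alpha> > -1\<close> put \<open>B\<^sub>\<alpha> q = (1 - x\<^sup>2) q' - 2 (\<alpha> + 1) x q\<close> and
  \<open>E\<^sub>\<alpha> p = - B\<^sub>\<alpha> (p') = (x\<^sup>2 - 1) p'' + 2 (\<alpha> + 1) x p'\<close>. The ultraspherical polynomial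
  \<open>P\<^sub>n\<close> with parameter \<open>\<alpha>\<close> is an eigenvector of \<open>E\<^sub>\<alpha>\<close> for \<open>c(n) = n (n + 2 \<alpha> + 1)\<close>. This
  is \<open>n\<^sup>2\<close> for \<open>\<alpha> = -1/2\<close> and \<open>n (n + 2)\<close> for \<open>\<alpha> = 1/2\<close>, so both claims say that
  \<open>\<Prod>k<w. (E\<^sub>\<alpha> - c(k)) ^ m k\<close> does not increase the number of non-real zeros. The individual
  factors need not have that property; the product has it because it can be rearranged into
  operators which do.

  Two such operators suffice. Differentiation is one, by Rolle's theorem. The other is \<open>B\<^sub>\<alpha>\<close>:
  up to sign, \<open>\<bar>1 - x\<^sup>2\<bar> powr \<alpha> * B\<^sub>\<alpha> q\<close> is the derivative of
  \<open>\<bar>1 - x\<^sup>2\<bar> powr (\<alpha> + 1) * q\<close>, and as \<open>\<alpha> + 1 > 0\<close> this function also vanishes at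
  \<open>1\<close> and \<open>-1\<close>. Rolle's theorem between consecutive points of the zero set of \<open>q\<close> together
  with \<open>1\<close> and \<open>-1\<close> gives one more real zero of \<open>B\<^sub>\<alpha> q\<close> than \<open>q\<close> has, while the degree
  grows by at most one (\<open>nonreal_zeros_gegenbauer_raise_le\<close>).

  For the rearrangement, differentiation turns \<open>E\<^sub>\<alpha>\<close> into \<open>E\<^sub>\<alpha>\<^sub>+\<^sub>1 + 2 (\<alpha> + 1)\<close>, and
  \<open>c(k + 1) - 2 (\<alpha> + 1)\<close> is the \<open>k\<close>-th eigenvalue for the parameter \<open>\<alpha> + 1\<close>. Since
  \<open>c(0) = 0\<close>, one of the \<open>m 0\<close> factors \<open>E\<^sub>\<alpha> = - B\<^sub>\<alpha> \<circ> d/dx\<close> can be pulled apart around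
  the factors with \<open>k \<ge> 1\<close>, leaving
  \<open>E\<^sub>\<alpha> ^ (m 0 - 1) \<circ> (- B\<^sub>\<alpha>) \<circ> Q \<circ> d/dx\<close>, where \<open>Q\<close> is a product of the same
  kind with \<open>w - 1\<close> in place of \<open>w\<close> and \<open>\<alpha> + 1\<close> in place of \<open>\<alpha>\<close>. This recursion is
  \<open>gegenbauer_multiplier\<close>. The hypothesis \<open>m 0 > 0\<close> is what makes a factor available for
  pulling apart.
\<close>

section \<open>Non-real zeros as degree minus real zeros\<close>

lemma map_poly_of_real_mult:
  "map_poly complex_of_real (p * q) = map_poly complex_of_real p * map_poly complex_of_real q"
  by (intro poly_eqI) (simp add: coeff_map_poly coeff_mult)

lemma map_poly_of_real_power:
  "map_poly complex_of_real (p ^ n) = map_poly complex_of_real p ^ n"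
  by (induction n) (simp_all add: map_poly_of_real_mult)

lemma poly_map_poly_of_real:
  "poly (map_poly complex_of_real p) (complex_of_real x) = complex_of_real (poly p x)"
  by (induction p) (simp_all add: map_poly_pCons)

lemma map_poly_of_real_eq_0_iff: "map_poly complex_of_real p = 0 \<longleftrightarrow> p = 0"
  by (simp add: map_poly_eq_0_iff)

lemma order_map_poly_of_real:
  assumes "p \<noteq> 0"
  shows "order (complex_of_real x) (map_poly complex_of_real p) = order x p"
proof -
  obtain q where q: "p = [:-x, 1:] ^ order x p * q" "\<not> [:-x, 1:] dvd q"
    using order_decomp[OF assms] by blast
  have "poly (map_poly complex_of_real q) (complex_of_real x) \<noteq> 0"
    using q(2) by (simp add: poly_map_poly_of_real poly_eq_0_iff_dvd)
  then have "order (complex_of_real x) (map_poly complex_of_real q) = 0"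
    and "map_poly complex_of_real q \<noteq> 0"
    by (auto intro: order_0I)
  moreover have "map_poly complex_of_real p =
      [:- complex_of_real x, 1:] ^ order x p * map_poly complex_of_real q"
    by (subst q(1)) (simp add: map_poly_of_real_mult map_poly_of_real_power map_poly_pCons)
  ultimately show ?thesis
    by (simp add: order_mult order_power_n_n)
qed

lemma size_proots_conv_sum:
  assumes "p \<noteq> 0"
  shows "size (proots p) = (\<Sum>x | poly p x = 0. order x p)"
  using assms by (simp add: size_multiset_overloaded_eq)

text \<open>
  This turns upper bounds for non-real zeros into lower bounds for real ones, which are
  accessible to Rolle's theorem.
\<close>
lemma nonreal_zeros_conv_degree:
  assumes "p \<noteq> 0"
  shows "Z\<^sub>C p + size (proots p) = degree p"
proof -
  let ?P = "map_poly complex_of_real p"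
  have P: "?P \<noteq> 0" using assms by (simp add: map_poly_of_real_eq_0_iff)
  let ?R = "complex_of_real ` {x. poly p x = 0}" and ?N = "{z. poly ?P z = 0 \<and> Im z \<noteq> 0}"
  have fin: "finite {z. poly ?P z = 0}" using P by (rule poly_roots_finite)
  have split: "{z. poly ?P z = 0} = ?N \<union> ?R"
  proof (intro set_eqI iffI)
    fix z assume z: "z \<in> {z. poly ?P z = 0}"
    show "z \<in> ?N \<union> ?R"
    proof (cases "Im z = 0")
      case True
      then have re: "z = complex_of_real (Re z)" by (simp add: complex_eq_iff)
      have "complex_of_real (poly p (Re z)) = poly ?P z"
        by (subst (2) re) (rule poly_map_poly_of_real[symmetric])
      then have "Re z \<in> {x. poly p x = 0}" using z by simp
      with re have "z \<in> ?R" by (rule image_eqI)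
      then show ?thesis ..
    qed (use z in auto)
  qed (auto simp: poly_map_poly_of_real)
  have "degree p = size (proots ?P)"
    by (simp add: size_proots_complex degree_map_poly)
  also have "\<dots> = (\<Sum>z | poly ?P z = 0. order z ?P)" by (rule size_proots_conv_sum[OF P])
  also have "\<dots> = (\<Sum>z\<in>?N. order z ?P) + (\<Sum>z\<in>?R. order z ?P)"
    unfolding split using fin unfolding split by (intro sum.union_disjoint) auto
  also have "(\<Sum>z\<in>?R. order z ?P) = (\<Sum>x | poly p x = 0. order x p)"
    by (subst sum.reindex) (simp_all add: inj_on_def order_map_poly_of_real[OF assms])
  also have "\<dots> = size (proots p)" by (rule size_proots_conv_sum[OF assms, symmetric])
  finally show ?thesis using assms by (simp add: nonreal_zeros_def)
qed

section \<open>Counting real zeros by Rolle's theorem\<close>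

text \<open>
  The bound \<open>z < Max S\<close> serves the induction: when a new maximum is added to \<open>S\<close>, it keeps the
  old points apart from the new one, which lies beyond the old maximum.
\<close>
lemma finite_separating_set:
  fixes S :: "'a::linorder set"
  assumes "finite S" "S \<noteq> {}"
    and "\<And>u v. u \<in> S \<Longrightarrow> v \<in> S \<Longrightarrow> u < v \<Longrightarrow> {u<..<v} \<inter> S = {} \<Longrightarrow> \<exists>z. u < z \<and> z < v \<and> P z"
  shows "\<exists>R. finite R \<and> R \<inter> S = {} \<and> (\<forall>z\<in>R. z < Max S \<and> P z) \<and> card S = Suc (card R)"
  using assms
proof (induction S rule: finite_linorder_max_induct)
  case (insert b A)
  show ?case
  proof (cases "A = {}")
    case True
    then show ?thesis by (intro exI[of _ "{}"]) auto
  next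
    case False
    let ?a = "Max A"
    have a: "?a \<in> A" "?a < b" using insert.hyps False by auto
    have nb: "b \<notin> A" using insert.hyps by auto
    have "\<exists>R. finite R \<and> R \<inter> A = {} \<and> (\<forall>z\<in>R. z < Max A \<and> P z) \<and> card A = Suc (card R)"
    proof (rule insert.IH[OF False])
      fix u v assume uv: "u \<in> A" "v \<in> A" "u < v" "{u<..<v} \<inter> A = {}"
      moreover have "b \<notin> {u<..<v}" using uv insert.hyps by auto
      ultimately show "\<exists>z. u < z \<and> z < v \<and> P z" by (intro insert.prems) auto
    qed
    then obtain R where R: "finite R" "R \<inter> A = {}" "\<And>z. z \<in> R \<Longrightarrow> z < ?a \<and> P z"
        "card A = Suc (card R)" by blast
    have "{?a<..<b} \<inter> insert b A = {}"
      using insert.hyps(1) by (fastforce dest: Max_ge)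
    then obtain z where z: "?a < z" "z < b" "P z"
      using insert.prems(2)[of ?a b] a by auto
    have zA: "z \<notin> A" using z insert.hyps(1) Max_ge[of A z] by (auto simp: not_less[symmetric])
    have "Max (insert b A) = b" using insert.hyps by (intro Max_eqI) (auto intro: less_imp_le)
    moreover have "z \<notin> R" "b \<notin> R" using R(3) z a by force+
    ultimately show ?thesis
      using R z zA nb a insert.hyps(1)
      by (intro exI[of _ "insert z R"]) (auto dest!: R(3))
  qed
qed auto

text \<open>
  The form in which Rolle's theorem is used twice below, for \<open>g = p'\<close> and for
  \<open>g = B\<^sub>\<alpha> q\<close>. The zeros in the gaps lie outside \<open>S\<close>, so they add to the multiplicities
  \<open>e\<close> inherited on \<open>S\<close>.
\<close>
lemma size_proots_ge_gaps:
  fixes g :: "real poly"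
  assumes "g \<noteq> 0" "finite S" "S \<noteq> {}"
    and mult: "\<And>x. x \<in> S \<Longrightarrow> e x \<le> order x g"
    and gap: "\<And>u v. u \<in> S \<Longrightarrow> v \<in> S \<Longrightarrow> u < v \<Longrightarrow> {u<..<v} \<inter> S = {} \<Longrightarrow>
                \<exists>z. u < z \<and> z < v \<and> poly g z = 0"
  shows "(\<Sum>x\<in>S. e x) + card S \<le> Suc (size (proots g))"
proof -
  have "\<exists>R. finite R \<and> R \<inter> S = {} \<and> (\<forall>z\<in>R. z < Max S \<and> poly g z = 0) \<and> card S = Suc (card R)"
    using assms(2,3) gap by (rule finite_separating_set)
  then obtain R where R: "finite R" "R \<inter> S = {}" "\<And>z. z \<in> R \<Longrightarrow> poly g z = 0"
      "card S = Suc (card R)"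
    by (elim exE conjE) blast
  let ?Z = "{x. poly g x = 0}"
  have fin: "finite ?Z" using \<open>g \<noteq> 0\<close> by (rule poly_roots_finite)
  have "card R = (\<Sum>x\<in>R. 1)" by simp
  also have "\<dots> \<le> (\<Sum>x\<in>R. order x g)"
    using R(3) \<open>g \<noteq> 0\<close> by (intro sum_mono) (simp add: order_root Suc_le_eq)
  finally have "(\<Sum>x\<in>S. e x) + card R \<le> (\<Sum>x\<in>S. order x g) + (\<Sum>x\<in>R. order x g)"
    using mult by (intro add_mono sum_mono) auto
  also have "\<dots> = (\<Sum>x\<in>S \<union> R. order x g)"
    using R assms by (intro sum.union_disjoint[symmetric]) auto
  also have "\<dots> \<le> (\<Sum>x\<in>S \<union> R \<union> ?Z. order x g)"
    using R assms fin by (intro sum_mono2) auto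
  also have "\<dots> = (\<Sum>x\<in>?Z. order x g)"
    using R assms fin by (intro sum.mono_neutral_right) (auto simp: order_root)
  also have "\<dots> = size (proots g)" using \<open>g \<noteq> 0\<close> by (simp add: size_proots_conv_sum)
  finally show ?thesis using R(4) by simp
qed

lemma power_dvd_pderiv:
  fixes q :: "real poly"
  assumes "[:-c, 1:] ^ k dvd q"
  shows "[:-c, 1:] ^ (k - 1) dvd pderiv q"
proof (cases k)
  case (Suc n)
  obtain r where r: "q = [:-c, 1:] ^ Suc n * r" using assms Suc by (auto elim: dvdE)
  show ?thesis unfolding r pderiv_mult pderiv_power_Suc
    unfolding Suc diff_Suc_1 power_Suc
    by (intro dvd_add dvd_mult dvd_mult2 dvd_smult dvd_refl)
qed auto

text \<open>
  If \<open>p\<close> has \<open>r\<close> real zeros, \<open>s\<close> of them distinct, then \<open>p'\<close> has at least \<open>r - s\<close> zeros at those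
  points and \<open>s - 1\<close> between them, hence at least \<open>r - 1\<close>; the degree drops by one as well.
\<close>
lemma nonreal_zeros_pderiv_le: "Z\<^sub>C (pderiv p) \<le> Z\<^sub>C p"
proof (cases "pderiv p = 0")
  case False
  then have p: "p \<noteq> 0" "degree p \<noteq> 0" by (auto simp: pderiv_eq_0_iff)
  let ?S = "{x. poly p x = 0}"
  have fin: "finite ?S" using p(1) by (rule poly_roots_finite)
  have "size (proots p) \<le> Suc (size (proots (pderiv p)))"
  proof (cases "?S = {}")
    case True
    then show ?thesis using p by (simp add: size_proots_conv_sum)
  next
    case nonempty: False
    have "size (proots p) = (\<Sum>x\<in>?S. (order x p - 1) + 1)"
      using p(1) by (auto simp: size_proots_conv_sum order_root intro!: sum.cong)
    also have "\<dots> = (\<Sum>x\<in>?S. order x p - 1) + card ?S" by (simp only: sum.distrib card_eq_sum)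
    also have "\<dots> \<le> Suc (size (proots (pderiv p)))"
    proof (rule size_proots_ge_gaps[OF False fin nonempty])
      fix x
      have "[:-x, 1:] ^ (order x p - 1) dvd pderiv p"
        by (intro power_dvd_pderiv order_1)
      then show "order x p - 1 \<le> order x (pderiv p)" using False by (simp add: order_divides)
    next
      fix u v assume "u \<in> ?S" "v \<in> ?S" "u < v"
      then show "\<exists>z. u < z \<and> z < v \<and> poly (pderiv p) z = 0"
        using poly_MVT[of u v p] by auto
    qed
    finally show ?thesis .
  qed
  moreover have "degree (pderiv p) = degree p - 1" by (rule degree_pderiv)
  ultimately show ?thesis
    using nonreal_zeros_conv_degree[OF False] nonreal_zeros_conv_degree[OF p(1)] p(2) by linarith
qed (simp add: nonreal_zeros_def)

section \<open>The operator that raises the degree\<close>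

text \<open>
  On \<open>(-1, 1)\<close> this is \<open>(1 - x\<^sup>2) powr (-\<alpha>) * d/dx ((1 - x\<^sup>2) powr (\<alpha> + 1) * q)\<close>. It maps
  ultraspherical polynomials of degree \<open>n\<close> for \<open>\<alpha> + 1\<close> to those of degree \<open>n + 1\<close>
  for \<open>\<alpha>\<close>, up to a constant.
\<close>
definition gegenbauer_raise :: "real \<Rightarrow> real poly \<Rightarrow> real poly" where
  "gegenbauer_raise \<alpha> q = [:1, 0, -1:] * pderiv q - smult (2 * (\<alpha> + 1)) ([:0, 1:] * q)"

lemma coeff_gegenbauer_raise:
  "coeff (gegenbauer_raise \<alpha> q) (Suc n) =
     (real n + 2) * coeff q (Suc (Suc n)) - (real n + 2 * (\<alpha> + 1)) * coeff q n"
  by (cases n) (simp_all add: gegenbauer_raise_def coeff_pderiv algebra_simps)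

lemma degree_gegenbauer_raise_le: "degree (gegenbauer_raise \<alpha> q) \<le> Suc (degree q)"
proof (rule degree_le, intro allI impI)
  fix i assume "Suc (degree q) < i"
  then show "coeff (gegenbauer_raise \<alpha> q) i = 0"
    by (cases i) (simp_all add: coeff_gegenbauer_raise coeff_eq_0)
qed

lemma gegenbauer_raise_nonzero:
  assumes "\<alpha> > -1" "q \<noteq> 0"
  shows "gegenbauer_raise \<alpha> q \<noteq> 0"
proof -
  have "coeff (gegenbauer_raise \<alpha> q) (Suc (degree q)) =
      - (real (degree q) + 2 * (\<alpha> + 1)) * lead_coeff q"
    by (simp add: coeff_gegenbauer_raise coeff_eq_0 algebra_simps)
  moreover have "real (degree q) + 2 * (\<alpha> + 1) > 0" using assms by (intro add_nonneg_pos) auto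
  ultimately have "coeff (gegenbauer_raise \<alpha> q) (Suc (degree q)) \<noteq> 0" using assms by simp
  then show ?thesis by auto
qed

text \<open>
  Rolle's theorem for \<open>(s (1 - x\<^sup>2)) powr (\<alpha> + 1) * q\<close>. The sign \<open>s\<close> makes the base
  positive, so that intervals inside and outside \<open>(-1, 1)\<close> are treated alike.
\<close>
lemma gegenbauer_raise_root:
  assumes "\<alpha> > -1" "u < v"
    and side: "\<bar>s\<bar> = 1" "\<And>x. u < x \<Longrightarrow> x < v \<Longrightarrow> s * (1 - x\<^sup>2) > 0"
    and "poly q u = 0 \<or> u\<^sup>2 = 1" "poly q v = 0 \<or> v\<^sup>2 = 1"
  shows "\<exists>z. u < z \<and> z < v \<and> poly (gegenbauer_raise \<alpha> q) z = 0"
proof -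
  define f where "f x = (s * (1 - x\<^sup>2)) powr (\<alpha> + 1) * poly q x" for x
  define f' where "f' x = s * (s * (1 - x\<^sup>2)) powr \<alpha> * poly (gegenbauer_raise \<alpha> q) x" for x
  have "{u..v} \<subseteq> {x. 0 \<le> s * (1 - x\<^sup>2)}"
  proof -
    have "closed {x. 0 \<le> s * (1 - x\<^sup>2)}" by (intro closed_Collect_le continuous_intros)
    moreover have "{u<..<v} \<subseteq> {x. 0 \<le> s * (1 - x\<^sup>2)}" using side(2) by (auto intro: less_imp_le)
    ultimately have "closure {u<..<v} \<subseteq> {x. 0 \<le> s * (1 - x\<^sup>2)}" by (rule closure_minimal[rotated])
    then show ?thesis using \<open>u < v\<close> by simp
  qed
  then have "continuous_on {u..v} f"
    unfolding f_def using \<open>\<alpha> > -1\<close>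
    by (intro continuous_intros continuous_on_powr') auto
  moreover have "f u = f v" using assms by (auto simp: f_def)
  moreover have "(f has_real_derivative f' x) (at x)" if "u < x" "x < v" for x
  proof -
    have pos: "s * (1 - x\<^sup>2) > 0" by (rule side(2)[OF that])
    have "((\<lambda>x. s * (1 - x\<^sup>2)) has_real_derivative - (2 * s * x)) (at x)"
      by (auto intro!: derivative_eq_intros)
    from DERIV_mult[OF DERIV_fun_powr[OF this pos, of "\<alpha> + 1"] poly_DERIV[of q x]]
    have "(f has_real_derivative
        (\<alpha> + 1) * (s * (1 - x\<^sup>2)) powr \<alpha> * - (2 * s * x) * poly q x
        + poly (pderiv q) x * (s * (1 - x\<^sup>2)) powr (\<alpha> + 1)) (at x)"
      unfolding f_def by simp
    moreover have "(s * (1 - x\<^sup>2)) powr (\<alpha> + 1) = (s * (1 - x\<^sup>2)) powr \<alpha> * (s * (1 - x\<^sup>2))"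
      using pos by (simp add: powr_add)
    ultimately have "(f has_real_derivative
        (\<alpha> + 1) * (s * (1 - x\<^sup>2)) powr \<alpha> * - (2 * s * x) * poly q x
        + poly (pderiv q) x * ((s * (1 - x\<^sup>2)) powr \<alpha> * (s * (1 - x\<^sup>2)))) (at x)"
      by (simp only:)
    moreover have "(\<alpha> + 1) * P * - (2 * s * x) * poly q x
        + poly (pderiv q) x * (P * (s * (1 - x\<^sup>2))) = s * P * poly (gegenbauer_raise \<alpha> q) x" for P
      by (simp add: gegenbauer_raise_def algebra_simps power2_eq_square)
    ultimately show ?thesis by (simp only: f'_def)
  qed
  ultimately have "\<exists>z. u < z \<and> z < v \<and> (*) (f' z) = (\<lambda>v. 0)"
    using \<open>u < v\<close> by (intro Rolle_deriv[of u v f]) (auto simp: has_field_derivative_def)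
  then obtain z where z: "u < z" "z < v" "(*) (f' z) = (\<lambda>v. 0)" by blast
  have "f' z = 0" using fun_cong[OF z(3), of 1] by simp
  moreover have "s * (1 - z\<^sup>2) > 0" using side(2) z by blast
  ultimately show ?thesis using z side(1) by (auto simp: f'_def)
qed

text \<open>
  The factor \<open>1 - x\<^sup>2\<close> prevents the loss of multiplicity at \<open>1\<close> and \<open>-1\<close>. If \<open>q\<close> has
  \<open>r\<close> real zeros and \<open>t\<close> is the number of distinct zeros other than \<open>1\<close> and \<open>-1\<close>,
  then the image has at least \<open>r - t\<close> zeros at the zeros of \<open>q\<close>, and \<open>t + 1\<close> in the gaps between the
  \<open>t + 2\<close> points that include \<open>1\<close> and \<open>-1\<close>.
\<close>
lemma nonreal_zeros_gegenbauer_raise_le: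
  assumes "\<alpha> > -1"
  shows "Z\<^sub>C (gegenbauer_raise \<alpha> q) \<le> Z\<^sub>C q"
proof (cases "q = 0")
  case False
  let ?g = "gegenbauer_raise \<alpha> q"
  let ?I = "{-1, 1::real}" and ?Z = "{x. poly q x = 0}"
  have g: "?g \<noteq> 0" by (rule gegenbauer_raise_nonzero[OF assms False])
  have fin: "finite ?Z" using False by (rule poly_roots_finite)
  \<comment> \<open>the multiplicity that \<open>q\<close> passes on to \<open>?g\<close> at \<open>x\<close>\<close>
  define e where "e x = (if x \<in> ?I then order x q else order x q - 1)" for x
  have e: "e x + 1 = order x q + of_bool (x \<in> ?I)" if "x \<in> ?Z \<union> ?I" for x
    using that False by (auto simp: e_def order_root)
  have "size (proots q) = (\<Sum>x\<in>?Z \<union> ?I. order x q)"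
    unfolding size_proots_conv_sum[OF False]
    using fin by (intro sum.mono_neutral_left) (auto simp: order_root)
  moreover have "(\<Sum>x\<in>?Z \<union> ?I. of_bool (x \<in> ?I)) = (\<Sum>x\<in>?I. of_bool (x \<in> ?I) :: nat)"
    using fin by (intro sum.mono_neutral_right) auto
  moreover have "(\<Sum>x\<in>?I. of_bool (x \<in> ?I)) = (2::nat)" by simp
  ultimately have "size (proots q) + 2 = (\<Sum>x\<in>?Z \<union> ?I. order x q + of_bool (x \<in> ?I))"
    by (simp only: sum.distrib)
  also have "\<dots> = (\<Sum>x\<in>?Z \<union> ?I. e x + 1)" using e by (intro sum.cong) simp_all
  also have "\<dots> = (\<Sum>x\<in>?Z \<union> ?I. e x) + card (?Z \<union> ?I)" by (simp only: sum.distrib card_eq_sum)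
  also have "\<dots> \<le> Suc (size (proots ?g))"
  proof (rule size_proots_ge_gaps[OF g])
    fix x assume "x \<in> ?Z \<union> ?I"
    have q: "[:-x, 1:] ^ e x dvd q"
      by (rule dvd_trans[OF le_imp_power_dvd order_1]) (simp add: e_def)
    have "[:-x, 1:] ^ e x dvd [:1, 0, -1:] * pderiv q"
    proof (cases "x \<in> ?I")
      case True
      then have "[:-x, 1:] dvd [:1, 0, -1:]" by (auto simp: poly_eq_0_iff_dvd[symmetric])
      then have "[:-x, 1:] ^ Suc (order x q - 1) dvd [:1, 0, -1:] * pderiv q"
        unfolding power_Suc by (intro mult_dvd_mono power_dvd_pderiv order_1)
      then show ?thesis by (rule dvd_trans[OF le_imp_power_dvd, rotated]) (use True in \<open>auto simp: e_def\<close>)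
    next
      case False
      then show ?thesis using power_dvd_pderiv[OF order_1[of x q]] by (simp add: e_def del: mult_pCons_left)
    qed
    with q have "[:-x, 1:] ^ e x dvd ?g"
      unfolding gegenbauer_raise_def by (intro dvd_diff dvd_smult dvd_mult[OF q])
    then show "e x \<le> order x ?g" using g by (simp add: order_divides)
  next
    fix u v assume uv: "u \<in> ?Z \<union> ?I" "v \<in> ?Z \<union> ?I" "u < v" "{u<..<v} \<inter> (?Z \<union> ?I) = {}"
    have sq: "y\<^sup>2 < 1 \<longleftrightarrow> -1 < y \<and> y < 1" for y :: real
      by (auto simp: abs_square_less_1 abs_less_iff)
    have sq': "y\<^sup>2 > 1 \<longleftrightarrow> y < -1 \<or> 1 < y" for y :: real
      using abs_square_le_1[of y] by (auto simp: not_le[symmetric] abs_le_iff)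
    have ne: "1 \<notin> {u<..<v}" "-1 \<notin> {u<..<v}" using uv(4) by blast+
    \<comment> \<open>\<open>1\<close> and \<open>-1\<close> are not inside the gap, so \<open>1 - x\<^sup>2\<close> keeps its sign there\<close>
    consider "\<And>x. u < x \<Longrightarrow> x < v \<Longrightarrow> 1 * (1 - x\<^sup>2) > 0"
      | "\<And>x. u < x \<Longrightarrow> x < v \<Longrightarrow> (-1) * (1 - x\<^sup>2) > 0"
    proof -
      have "v \<le> -1 \<or> (-1 \<le> u \<and> v \<le> 1) \<or> 1 \<le> u" using ne by auto
      then show thesis using that by (auto simp: sq sq')
    qed
    then show "\<exists>z. u < z \<and> z < v \<and> poly ?g z = 0"
    proof cases
      case 1
      then show ?thesis using uv by (intro gegenbauer_raise_root[OF assms, where s = 1]) auto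
    next
      case 2
      then show ?thesis using uv by (intro gegenbauer_raise_root[OF assms, where s = "-1"]) auto
    qed
  qed (use fin in auto)
  finally have "size (proots q) + 1 \<le> size (proots ?g)" by simp
  then show ?thesis
    using nonreal_zeros_conv_degree[OF g] nonreal_zeros_conv_degree[OF False]
      degree_gegenbauer_raise_le[of \<alpha> q] by linarith
qed (simp add: nonreal_zeros_def gegenbauer_raise_def)

lemma nonreal_zeros_smult_le: "Z\<^sub>C (smult c p) \<le> Z\<^sub>C p"
proof (cases "c = 0 \<or> p = 0")
  case False
  then show ?thesis
    using nonreal_zeros_conv_degree[of p] nonreal_zeros_conv_degree[of "smult c p"] by auto
qed (auto simp: nonreal_zeros_def)

section \<open>The Gegenbauer differential operator\<close>
definition gegenbauer_op :: "real \<Rightarrow> real poly \<Rightarrow> real poly" where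
  "gegenbauer_op \<alpha> p = - gegenbauer_raise \<alpha> (pderiv p)"

lemma nonreal_zeros_gegenbauer_op_le:
  assumes "\<alpha> > -1"
  shows "Z\<^sub>C (gegenbauer_op \<alpha> p) \<le> Z\<^sub>C p"
  using nonreal_zeros_smult_le[of "-1" "gegenbauer_raise \<alpha> (pderiv p)"]
    nonreal_zeros_gegenbauer_raise_le[OF assms, of "pderiv p"] nonreal_zeros_pderiv_le[of p]
  by (simp add: gegenbauer_op_def)

text \<open>
  The commutation relation behind both directions of the parameter shift: applied to a derivative
  it moves eigenvectors from \<open>\<alpha>\<close> up to \<open>\<alpha> + 1\<close>, and under the raising operator from
  \<open>\<alpha> + 1\<close> down to \<open>\<alpha>\<close>.
\<close>
lemma pderiv_gegenbauer_raise:
  "pderiv (gegenbauer_raise \<alpha> q) =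
     gegenbauer_raise (\<alpha> + 1) (pderiv q) - smult (2 * (\<alpha> + 1)) q"
proof (rule poly_eqI)
  fix n show "coeff (pderiv (gegenbauer_raise \<alpha> q)) n =
      coeff (gegenbauer_raise (\<alpha> + 1) (pderiv q) - smult (2 * (\<alpha> + 1)) q) n"
  proof (cases n)
    case 0
    then show ?thesis
      by (simp add: coeff_pderiv coeff_gegenbauer_raise) (simp add: gegenbauer_raise_def coeff_pderiv algebra_simps numeral_2_eq_2)
  next
    case (Suc k)
    then show ?thesis
      by (simp add: coeff_pderiv coeff_gegenbauer_raise algebra_simps)
  qed
qed

lemma gegenbauer_raise_smult: "gegenbauer_raise \<alpha> (smult c q) = smult c (gegenbauer_raise \<alpha> q)"
  by (simp add: gegenbauer_raise_def pderiv_smult algebra_simps smult_diff_right)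

lemma gegenbauer_raise_add:
  "gegenbauer_raise \<alpha> (p + q) = gegenbauer_raise \<alpha> p + gegenbauer_raise \<alpha> q"
  by (simp add: gegenbauer_raise_def pderiv_add algebra_simps smult_add_right)

lemma gegenbauer_op_smult: "gegenbauer_op \<alpha> (smult c p) = smult c (gegenbauer_op \<alpha> p)"
  by (simp add: gegenbauer_op_def pderiv_smult gegenbauer_raise_smult)

lemma gegenbauer_op_add: "gegenbauer_op \<alpha> (p + q) = gegenbauer_op \<alpha> p + gegenbauer_op \<alpha> q"
  by (simp add: gegenbauer_op_def pderiv_add gegenbauer_raise_add)

lemma gegenbauer_op_pderiv_eigen:
  assumes "gegenbauer_op \<alpha> p = smult c p"
  shows "gegenbauer_op (\<alpha> + 1) (pderiv p) = smult (c - 2 * (\<alpha> + 1)) (pderiv p)"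
proof -
  have "smult c (pderiv p) = pderiv (gegenbauer_op \<alpha> p)" by (simp add: assms pderiv_smult)
  also have "\<dots> = gegenbauer_op (\<alpha> + 1) (pderiv p) + smult (2 * (\<alpha> + 1)) (pderiv p)"
    by (simp add: gegenbauer_op_def pderiv_minus pderiv_gegenbauer_raise)
  finally show ?thesis by (simp add: smult_diff_left)
qed

lemma gegenbauer_op_raise_eigen:
  assumes "gegenbauer_op (\<alpha> + 1) q = smult c q"
  shows "gegenbauer_op \<alpha> (gegenbauer_raise \<alpha> q) = smult (c + 2 * (\<alpha> + 1)) (gegenbauer_raise \<alpha> q)"
proof -
  have "- pderiv (gegenbauer_raise \<alpha> q) = gegenbauer_op (\<alpha> + 1) q + smult (2 * (\<alpha> + 1)) q"
    by (simp add: gegenbauer_op_def pderiv_gegenbauer_raise)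
  then have "- pderiv (gegenbauer_raise \<alpha> q) = smult (c + 2 * (\<alpha> + 1)) q"
    by (simp add: assms smult_add_left)
  then have "gegenbauer_raise \<alpha> (smult (-1) (pderiv (gegenbauer_raise \<alpha> q))) =
      smult (c + 2 * (\<alpha> + 1)) (gegenbauer_raise \<alpha> q)"
    by (simp add: gegenbauer_raise_smult)
  then show ?thesis unfolding gegenbauer_raise_smult by (simp add: gegenbauer_op_def)
qed

section \<open>Ultraspherical polynomials as eigenvectors\<close>
abbreviation gegenbauer_eigenvalue :: "real \<Rightarrow> nat \<Rightarrow> real" where
  "gegenbauer_eigenvalue \<alpha> n \<equiv> real n * (real n + 2 * \<alpha> + 1)"

text \<open>
  Each differentiation in Rodrigues' formula lowers the exponent of \<open>1 - x\<^sup>2\<close> by one and thus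
  acts as a raising operator on the polynomial factor. The eigenvector property then follows
  from that of the constant \<open>1\<close>, one step at a time.
\<close>
lemma rodrigues_factor_Suc:
  "rodrigues_factor a (Suc k) = gegenbauer_raise (a - real k - 1) (rodrigues_factor a k)"
  by (simp add: gegenbauer_raise_def mult.commute)

lemma gegenbauer_op_rodrigues_factor:
  "gegenbauer_op (a - real k) (rodrigues_factor a k) =
     smult (gegenbauer_eigenvalue (a - real k) k) (rodrigues_factor a k)"
proof (induction k)
  case 0
  then show ?case by (simp add: gegenbauer_op_def gegenbauer_raise_def)
next
  case (Suc k)
  have "gegenbauer_op (a - real k - 1 + 1) (rodrigues_factor a k) =
     smult (gegenbauer_eigenvalue (a - real k) k) (rodrigues_factor a k)"
    using Suc.IH by simp
  from gegenbauer_op_raise_eigen[OF this] show ?case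
    unfolding rodrigues_factor_Suc by (simp add: algebra_simps)
qed

lemma gegenbauer_op_ultraspherical:
  "gegenbauer_op \<alpha> (ultraspherical \<alpha> n) =
     smult (gegenbauer_eigenvalue \<alpha> n) (ultraspherical \<alpha> n)"
  using gegenbauer_op_rodrigues_factor[of "real n + \<alpha>" n]
  by (simp add: ultraspherical_eq_rodrigues_factor gegenbauer_op_smult mult.commute)

section \<open>The multiplier operator\<close>

text \<open>
  The rearranged form of \<open>\<Prod>k<w. (E\<^sub>\<alpha> - c(k)) ^ m k\<close>, taken as the definition because every
  constituent visibly preserves the bound on non-real zeros. It agrees with the product on
  eigenvectors of \<open>E\<^sub>\<alpha>\<close> when all exponents are positive, which is
  \<open>gegenbauer_multiplier_eigen\<close>.
\<close>
primrec gegenbauer_multiplier :: "nat \<Rightarrow> real \<Rightarrow> (nat \<Rightarrow> nat) \<Rightarrow> real poly \<Rightarrow> real poly" where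
  "gegenbauer_multiplier 0 \<alpha> m p = p"
| "gegenbauer_multiplier (Suc w) \<alpha> m p =
     (gegenbauer_op \<alpha> ^^ (m 0 - 1))
       (- gegenbauer_raise \<alpha> (gegenbauer_multiplier w (\<alpha> + 1) (\<lambda>k. m (Suc k)) (pderiv p)))"

lemma nonreal_zeros_gegenbauer_multiplier_le:
  assumes "\<alpha> > -1"
  shows "Z\<^sub>C (gegenbauer_multiplier w \<alpha> m p) \<le> Z\<^sub>C p"
  using assms
proof (induction w arbitrary: \<alpha> m p)
  case (Suc w)
  let ?q = "gegenbauer_multiplier w (\<alpha> + 1) (\<lambda>k. m (Suc k)) (pderiv p)"
  have iter: "Z\<^sub>C ((gegenbauer_op \<alpha> ^^ k) r) \<le> Z\<^sub>C r" for k r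
    by (induction k) (auto intro: order_trans[OF nonreal_zeros_gegenbauer_op_le[OF Suc.prems]])
  have "Z\<^sub>C (gegenbauer_multiplier (Suc w) \<alpha> m p) \<le> Z\<^sub>C (smult (-1) (gegenbauer_raise \<alpha> ?q))"
    using iter by simp
  also have "\<dots> \<le> Z\<^sub>C (gegenbauer_raise \<alpha> ?q)" by (rule nonreal_zeros_smult_le)
  also have "\<dots> \<le> Z\<^sub>C ?q" by (rule nonreal_zeros_gegenbauer_raise_le[OF Suc.prems])
  also have "\<dots> \<le> Z\<^sub>C (pderiv p)" using Suc.prems by (intro Suc.IH) simp
  also have "\<dots> \<le> Z\<^sub>C p" by (rule nonreal_zeros_pderiv_le)
  finally show ?case .
qed simp

lemma gegenbauer_multiplier_add:
  "gegenbauer_multiplier w \<alpha> m (p + q) = gegenbauer_multiplier w \<alpha> m p + gegenbauer_multiplier w \<alpha> m q"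
proof (induction w arbitrary: \<alpha> m p q)
  case (Suc w)
  have iter: "(gegenbauer_op \<alpha> ^^ k) (r + s) = (gegenbauer_op \<alpha> ^^ k) r + (gegenbauer_op \<alpha> ^^ k) s"
    for k r s by (induction k) (simp_all add: gegenbauer_op_add)
  show ?case by (simp only: gegenbauer_multiplier.simps pderiv_add Suc.IH gegenbauer_raise_add
      minus_add_distrib iter)
qed simp

lemma gegenbauer_op_funpow_smult:
  "(gegenbauer_op \<alpha> ^^ k) (smult c p) = smult c ((gegenbauer_op \<alpha> ^^ k) p)"
  by (induction k) (simp_all add: gegenbauer_op_smult)

lemma gegenbauer_multiplier_smult:
  "gegenbauer_multiplier w \<alpha> m (smult c p) = smult c (gegenbauer_multiplier w \<alpha> m p)"
proof (induction w arbitrary: \<alpha> m p)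
  case (Suc w)
  show ?case by (simp only: gegenbauer_multiplier.simps pderiv_smult Suc.IH gegenbauer_raise_smult
      smult_minus_right[symmetric] gegenbauer_op_funpow_smult)
qed simp

text \<open>
  The derivative of an eigenvector of \<open>E\<^sub>\<alpha>\<close> is one of \<open>E\<^sub>\<alpha>\<^sub>+\<^sub>1\<close>, so the inner
  operator acts on it as a scalar. What remains is \<open>E\<^sub>\<alpha>\<close> applied \<open>m 0\<close> times: \<open>m 0 - 1\<close>
  explicit applications, and one made of the differentiation and the outer raising operator.
\<close>
lemma gegenbauer_multiplier_eigen:
  assumes "gegenbauer_op \<alpha> p = smult c p" and "\<And>k. k < w \<Longrightarrow> m k > 0"
  shows "gegenbauer_multiplier w \<alpha> m p =
     smult (\<Prod>k<w. (c - gegenbauer_eigenvalue \<alpha> k) ^ m k) p"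
  using assms
proof (induction w arbitrary: \<alpha> m p c)
  case (Suc w)
  let ?P = "\<Prod>k<w. (c - gegenbauer_eigenvalue \<alpha> (Suc k)) ^ m (Suc k)"
  have shift: "c - 2 * (\<alpha> + 1) - gegenbauer_eigenvalue (\<alpha> + 1) k =
      c - gegenbauer_eigenvalue \<alpha> (Suc k)" for k
    by (simp add: algebra_simps)
  have iter: "(gegenbauer_op \<alpha> ^^ k) p = smult (c ^ k) p" for k
    by (induction k) (simp_all add: gegenbauer_op_smult Suc.prems(1) mult.commute)
  have "gegenbauer_multiplier w (\<alpha> + 1) (\<lambda>k. m (Suc k)) (pderiv p) = smult ?P (pderiv p)"
    unfolding shift[symmetric]
    using Suc.prems by (intro Suc.IH gegenbauer_op_pderiv_eigen) auto
  then have "gegenbauer_multiplier (Suc w) \<alpha> m p =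
      (gegenbauer_op \<alpha> ^^ (m 0 - 1)) (smult ?P (gegenbauer_op \<alpha> p))"
    by (simp add: gegenbauer_op_def gegenbauer_raise_smult)
  also have "\<dots> = smult (?P * c * c ^ (m 0 - 1)) p"
    by (simp add: Suc.prems(1) gegenbauer_op_funpow_smult iter mult_ac)
  also have "?P * c * c ^ (m 0 - 1) = (\<Prod>k<Suc w. (c - gegenbauer_eigenvalue \<alpha> k) ^ m k)"
  proof -
    have "c * c ^ (m 0 - 1) = c ^ m 0"
      using Suc.prems(2)[of 0] by (simp flip: power_Suc)
    then show ?thesis
      by (simp add: prod.lessThan_Suc_shift mult_ac del: prod.lessThan_Suc)
  qed
  finally show ?case .
qed simp

section \<open>Complex zero decreasing sequences for ultraspherical bases\<close>
lemma real_poly_basis_if_degree_eq: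
  assumes deg: "\<And>n. degree (b n) = n" and nz: "\<And>n. b n \<noteq> 0"
  shows "real_poly_basis b"
proof -
  have inj: "inj b" using deg by (metis injI)
  have span_deg: "degree p < n" if "p \<in> real_poly.span (b ` {..<n})" "n > 0" for p n
    using that(1)
  proof (induction rule: real_poly.span_induct_alt)
    case (step c x y)
    have "degree (smult c x) < n" using step(1) deg by (auto intro: le_less_trans[OF degree_smult_le])
    then show ?case using step(2) by (rule degree_add_less)
  qed (use that in auto)
  have span_le: "p \<in> real_poly.span (b ` {..<n})" if "p = 0 \<or> degree p < n" for n p
    using that
  proof (induction n arbitrary: p)
    case (Suc n)
    let ?c = "coeff p n / lead_coeff (b n)"
    have "degree p \<le> n" using Suc.prems by auto
    then have "degree (p - smult ?c (b n)) \<le> n" by (intro degree_diff_le) (auto simp: deg)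
    moreover have "coeff (p - smult ?c (b n)) n = 0"
      using nz[of n] deg[of n] by (metis (no_types) coeff_diff coeff_smult diff_self leading_coeff_0_iff nonzero_eq_divide_eq)
    ultimately have "p - smult ?c (b n) = 0 \<or> degree (p - smult ?c (b n)) < n"
      by (metis le_neq_implies_less leading_coeff_0_iff)
    then have "p - smult ?c (b n) \<in> real_poly.span (b ` {..<n})" by (rule Suc.IH)
    then have "p - smult ?c (b n) \<in> real_poly.span (b ` {..<Suc n})"
      by (rule subsetD[OF real_poly.span_mono, rotated]) auto
    moreover have "smult ?c (b n) \<in> real_poly.span (b ` {..<Suc n})"
      by (intro real_poly.span_scale real_poly.span_base) auto
    ultimately show ?case using real_poly.span_add by fastforce
  qed auto
  have ind: "real_poly.independent (b ` {..<n})" for n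
  proof (induction n)
    case (Suc n)
    have "b n \<notin> real_poly.span (b ` {..<n})"
      using span_deg[of "b n" n] deg[of n] nz[of n] by (cases "n = 0") auto
    then show ?case using Suc by (simp add: lessThan_Suc real_poly.independent_insertI)
  qed (simp add: real_poly.independent_empty)
  have "real_poly.independent (range b)"
    unfolding real_poly.independent_explicit_finite_subsets
  proof (intro allI impI)
    fix S u assume S: "S \<subseteq> range b" "finite S" "(\<Sum>v\<in>S. smult (u v) v) = 0"
    obtain N where N: "finite N" "S = b ` N" using finite_subset_image[OF S(2,1)] by blast
    then have "S \<subseteq> b ` {..<Suc (Max N)}" by (auto simp: less_Suc_eq_le)
    then show "\<forall>v\<in>S. u v = 0" using real_poly.independentD[OF ind S(2) _ S(3)] by blast
  qed
  moreover have "real_poly.span (range b) = UNIV"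
  proof -
    have "p \<in> real_poly.span (range b)" for p
      using span_le[of p "Suc (degree p)"] real_poly.span_mono[of "b ` {..<Suc (degree p)}" "range b"] by auto
    then show ?thesis by blast
  qed
  ultimately show ?thesis using inj by (simp add: real_poly_basis_def)
qed

lemma ultraspherical_nonzero:
  assumes "\<alpha> > -1"
  shows "ultraspherical \<alpha> n \<noteq> 0"
  using rodrigues_factor_degree[of n "real n + \<alpha>" n] assms
  by (auto simp: ultraspherical_eq_rodrigues_factor)

text \<open>
  Rescaling basis vectors does not affect an operator that is diagonal on them, so the
  normalisation \<open>c\<close> may be any non-zero one; the two Chebyshev families differ from
  \<^const>\<open>ultraspherical\<close> only in this respect.
\<close>
theorem CZDS_ultraspherical:
  assumes "\<alpha> > -1" and "\<And>k. k < w \<Longrightarrow> m k > 0" and "\<And>n. c n \<noteq> 0"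
  shows "CZDS (\<lambda>n. smult (c n) (ultraspherical \<alpha> n))
     (\<lambda>n. \<Prod>k<w. (gegenbauer_eigenvalue \<alpha> n - gegenbauer_eigenvalue \<alpha> k) ^ m k)"
  unfolding CZDS_def
proof (intro conjI exI allI)
  let ?b = "\<lambda>n. smult (c n) (ultraspherical \<alpha> n)"
  show "real_poly_basis ?b"
    using assms by (intro real_poly_basis_if_degree_eq) (simp_all add: degree_ultraspherical ultraspherical_nonzero)
  show "Vector_Spaces.linear smult smult (gegenbauer_multiplier w \<alpha> m)"
    by (simp add: Vector_Spaces.linear_iff gegenbauer_multiplier_add gegenbauer_multiplier_smult
        real_poly.vector_space_axioms)
  show "gegenbauer_multiplier w \<alpha> m (?b n) =
      smult (\<Prod>k<w. (gegenbauer_eigenvalue \<alpha> n - gegenbauer_eigenvalue \<alpha> k) ^ m k) (?b n)" for n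
    using assms(2) by (intro gegenbauer_multiplier_eigen)
      (simp_all add: gegenbauer_op_smult gegenbauer_op_ultraspherical mult.commute)
  show "Z\<^sub>C (gegenbauer_multiplier w \<alpha> m p) \<le> Z\<^sub>C p" for p
    by (rule nonreal_zeros_gegenbauer_multiplier_le[OF assms(1)])
qed

theorem corollary16:
  fixes w :: nat and m :: "nat \<Rightarrow> nat"
  assumes "w > 0" and "\<And>k. k < w \<Longrightarrow> m k > 0"
  shows "CZDS chebyshev_T (\<lambda>n. \<Prod>k<w. ((real n)\<^sup>2 - (real k)\<^sup>2) ^ m k)
       \<and> CZDS chebyshev_U (\<lambda>n. \<Prod>k<w. (real n * (real n + 2) - real k * (real k + 2)) ^ m k)"
proof
  have nz: "pochhammer a n \<noteq> 0" if "a > 0" for a :: real and n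
    using pochhammer_pos[OF that, of n] by simp
  have T: "chebyshev_T = (\<lambda>n. smult (fact n / pochhammer (1/2) n) (ultraspherical (-1/2) n))"
    by (simp add: fun_eq_iff chebyshev_T_def)
  have U: "chebyshev_U = (\<lambda>n. smult (fact (n + 1) / pochhammer (3/2) n) (ultraspherical (1/2) n))"
    by (simp add: fun_eq_iff chebyshev_U_def)
  show "CZDS chebyshev_T (\<lambda>n. \<Prod>k<w. ((real n)\<^sup>2 - (real k)\<^sup>2) ^ m k)"
    using CZDS_ultraspherical[of "-1/2" w m "\<lambda>n. fact n / pochhammer (1/2) n"] assms(2)
    by (simp add: T nz power2_eq_square)
  show "CZDS chebyshev_U (\<lambda>n. \<Prod>k<w. (real n * (real n + 2) - real k * (real k + 2)) ^ m k)"
    using CZDS_ultraspherical[of "1/2" w m "\<lambda>n. fact (n + 1) / pochhammer (3/2) n"] assms(2)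
    by (simp add: U nz add.commute del: fact_Suc)
qed

end
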